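(* For any integer $\gamma \geq 0$, the vector space of nonempty words on $\{0\} \cup [\gamma]$ containing exactly one occurrence of $0$, endowed with the linear operations $\dashv_a, \vdash_a$, $a \in [\gamma]$, defined on such words $u$ and $v$ by $$u \dashv_a v := u\, \mathrm{h}_a(v), \qquad u \vdash_a v := \mathrm{h}_a(u)\, v$$ (concatenation of words), where $\mathrm{h}_a(w)$ is the word obtained by replacing in $w$ every occurrence of a letter smaller than $a$ by $a$, is the free $\gamma$-pluriassociative algebra over one generator.
   Context: The ground field has characteristic zero; $[\gamma]=\{1,\dots,\gamma\}$. A $\gamma$-pluriassociative algebra is an algebra over the nonsymmetric operad $\mathsf{Dias}_\gamma$, which is the operad generated by the words $0a$, $a0$, $a\in[\gamma]$, inside the operad of words on $\{0\}\cup[\gamma]$ (arity = length) with partial compositions $u \circ_i v := u_1 \dots u_{i-1}\max(u_i, v_1) \dots \max(u_i, v_m) u_{i+1} \dots u_n$ and unit the word $0$; the operation $\dashv_a$ is the action of $0a$ and $\vdash_a$ the action of $a0$. Equivalently, it is a vector space with bilinear operations $\dashv_a, \vdash_a$, $a \in [\gamma]$, such that for all elements $x,y,z$ and all $a, a' \in [\gamma]$, with $a \uparrow a' := \max(a,a')$: $(x \vdash_{a'} y) \dashv_a z = x \vdash_{a'} (y \dashv_a z)$; $(x \dashv_{a\uparrow a'} y) \dashv_a z = x \dashv_a (y \vdash_{a'} z)$; $(x \dashv_{a'} y) \vdash_a z = x \vdash_a (y \vdash_{a \uparrow a'} z)$; $(x \dashv_a y) \dashv_{a\uparrow a'} z =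 x \dashv_a (y \dashv_{a'} z)$; $(x \vdash_{a'} y) \vdash_a z = x \vdash_{a \uparrow a'} (y \vdash_a z)$. The free algebra over one generator on a nonsymmetric operad $\mathcal{O}$ is $\bigoplus_{n\ge1}\mathcal{O}(n)$ with action $x(e_1,\dots,e_n) := x\circ(e_1,\dots,e_n)$ (full operadic composition), the generator being the operad unit (here the word $0$). *)

theory Defs
  imports Complex_Main "HOL-Library.Poly_Mapping" "HOL-Library.FuncSet"
begin

section \<open>Linear combinations of words\<close>

text \<open>
  A vector of the free vector space on words is a finitely supported function
  from words to the ground field; the word \<open>w\<close> is the basis vector
  \<open>Poly_Mapping.single w 1\<close>.
\<close>

type_synonym 'k wvec = "nat list \<Rightarrow>\<^sub>0 'k"

abbreviation word_vec :: "nat list \<Rightarrow> 'k::zero_neq_one wvec" where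
  "word_vec w \<equiv> Poly_Mapping.single w 1"

definition wscale :: "'k::field \<Rightarrow> 'k wvec \<Rightarrow> 'k wvec" where
  "wscale c X = Poly_Mapping.map (\<lambda>x. c * x) X"

lemma lookup_wscale [simp]:
  "Poly_Mapping.lookup (wscale c X) w = c * Poly_Mapping.lookup X w"
  by (simp add: wscale_def Poly_Mapping.map.rep_eq when_def)

global_interpretation wvec: vector_space "wscale :: 'k::field \<Rightarrow> 'k wvec \<Rightarrow> 'k wvec"
  by standard (auto intro!: poly_mapping_eqI simp: lookup_add algebra_simps)

definition bilin_ext ::
  "(nat list \<Rightarrow> nat list \<Rightarrow> nat list) \<Rightarrow> 'k::field wvec \<Rightarrow> 'k wvec \<Rightarrow> 'k wvec"
where
  "bilin_ext f X Y =
     (\<Sum>u\<in>Poly_Mapping.keys X. \<Sum>v\<in>Poly_Mapping.keys Y.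
        Poly_Mapping.single (f u v) (Poly_Mapping.lookup X u * Poly_Mapping.lookup Y v))"

section \<open>Pluriassociative algebras\<close>

text \<open>
  The underlying vector space is a subspace \<open>V\<close> of an ambient vector space
  with scalar multiplication \<open>scale\<close>; \<open>L a\<close> and \<open>R a\<close> are the operations
  \<open>\<stileturn>\<^sub>a\<close> and \<open>\<turnstile>\<^sub>a\<close>, and they only matter on \<open>V\<close> and for \<open>a \<in> {1..\<gamma>}\<close>.
\<close>

locale pluriassociative_algebra =
  vector_space scale
  for scale :: "'k::field \<Rightarrow> 'v::ab_group_add \<Rightarrow> 'v" +
  fixes \<gamma> :: nat
    and V :: "'v set"
    and L R :: "nat \<Rightarrow> 'v \<Rightarrow> 'v \<Rightarrow> 'v"
  assumes V_subspace: "subspace V"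
    and L_closed: "\<lbrakk>a \<in> {1..\<gamma>}; x \<in> V; y \<in> V\<rbrakk> \<Longrightarrow> L a x y \<in> V"
    and R_closed: "\<lbrakk>a \<in> {1..\<gamma>}; x \<in> V; y \<in> V\<rbrakk> \<Longrightarrow> R a x y \<in> V"
    and L_add_left: "\<lbrakk>a \<in> {1..\<gamma>}; x \<in> V; y \<in> V; z \<in> V\<rbrakk> \<Longrightarrow> L a (x + y) z = L a x z + L a y z"
    and L_add_right: "\<lbrakk>a \<in> {1..\<gamma>}; x \<in> V; y \<in> V; z \<in> V\<rbrakk> \<Longrightarrow> L a x (y + z) = L a x y + L a x z"
    and L_scale_left: "\<lbrakk>a \<in> {1..\<gamma>}; x \<in> V; y \<in> V\<rbrakk> \<Longrightarrow> L a (scale c x) y = scale c (L a x y)"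
    and L_scale_right: "\<lbrakk>a \<in> {1..\<gamma>}; x \<in> V; y \<in> V\<rbrakk> \<Longrightarrow> L a x (scale c y) = scale c (L a x y)"
    and R_add_left: "\<lbrakk>a \<in> {1..\<gamma>}; x \<in> V; y \<in> V; z \<in> V\<rbrakk> \<Longrightarrow> R a (x + y) z = R a x z + R a y z"
    and R_add_right: "\<lbrakk>a \<in> {1..\<gamma>}; x \<in> V; y \<in> V; z \<in> V\<rbrakk> \<Longrightarrow> R a x (y + z) = R a x y + R a x z"
    and R_scale_left: "\<lbrakk>a \<in> {1..\<gamma>}; x \<in> V; y \<in> V\<rbrakk> \<Longrightarrow> R a (scale c x) y = scale c (R a x y)"
    and R_scale_right: "\<lbrakk>a \<in> {1..\<gamma>}; x \<in> V; y \<in> V\<rbrakk> \<Longrightarrow> R a x (scale c y) = scale c (R a x y)"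
    and rel_RL: "\<lbrakk>a \<in> {1..\<gamma>}; a' \<in> {1..\<gamma>}; x \<in> V; y \<in> V; z \<in> V\<rbrakk> \<Longrightarrow>
      L a (R a' x y) z = R a' x (L a y z)"
    and rel_L_right: "\<lbrakk>a \<in> {1..\<gamma>}; a' \<in> {1..\<gamma>}; x \<in> V; y \<in> V; z \<in> V\<rbrakk> \<Longrightarrow>
      L a (L (max a a') x y) z = L a x (R a' y z)"
    and rel_R_left: "\<lbrakk>a \<in> {1..\<gamma>}; a' \<in> {1..\<gamma>}; x \<in> V; y \<in> V; z \<in> V\<rbrakk> \<Longrightarrow>
      R a (L a' x y) z = R a x (R (max a a') y z)"
    and rel_LL: "\<lbrakk>a \<in> {1..\<gamma>}; a' \<in> {1..\<gamma>}; x \<in> V; y \<in> V; z \<in> V\<rbrakk> \<Longrightarrow>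
      L (max a a') (L a x y) z = L a x (L a' y z)"
    and rel_RR: "\<lbrakk>a \<in> {1..\<gamma>}; a' \<in> {1..\<gamma>}; x \<in> V; y \<in> V; z \<in> V\<rbrakk> \<Longrightarrow>
      R a (R a' x y) z = R (max a a') x (R a y z)"

definition pluriassociative_hom ::
  "nat \<Rightarrow>
   ('k::field \<Rightarrow> 'v::ab_group_add \<Rightarrow> 'v) \<Rightarrow> 'v set \<Rightarrow>
   (nat \<Rightarrow> 'v \<Rightarrow> 'v \<Rightarrow> 'v) \<Rightarrow> (nat \<Rightarrow> 'v \<Rightarrow> 'v \<Rightarrow> 'v) \<Rightarrow>
   ('k \<Rightarrow> 'w::ab_group_add \<Rightarrow> 'w) \<Rightarrow> 'w set \<Rightarrow>
   (nat \<Rightarrow> 'w \<Rightarrow> 'w \<Rightarrow> 'w) \<Rightarrow> (nat \<Rightarrow> 'w \<Rightarrow> 'w \<Rightarrow> 'w) \<Rightarrow>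
   ('v \<Rightarrow> 'w) \<Rightarrow> bool"
where
  "pluriassociative_hom \<gamma> scale V L R scale' V' L' R' f \<longleftrightarrow>
     f \<in> V \<rightarrow> V' \<and>
     (\<forall>x\<in>V. \<forall>y\<in>V. f (x + y) = f x + f y) \<and>
     (\<forall>c. \<forall>x\<in>V. f (scale c x) = scale' c (f x)) \<and>
     (\<forall>a\<in>{1..\<gamma>}. \<forall>x\<in>V. \<forall>y\<in>V. f (L a x y) = L' a (f x) (f y) \<and> f (R a x y) = R' a (f x) (f y))"

section \<open>The operad of words and its suboperad Dias\<close>

text \<open>Positions are numbered from \<open>1\<close>; the value is only meaningful for \<open>1 \<le> i \<le> length u\<close>.\<close>

definition word_comp :: "nat \<Rightarrow> nat list \<Rightarrow> nat list \<Rightarrow> nat list" where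
  "word_comp i u v = take (i - 1) u @ map (max (u ! (i - 1))) v @ drop i u"

definition operad_comp :: "nat \<Rightarrow> 'k::field wvec \<Rightarrow> 'k wvec \<Rightarrow> 'k wvec" where
  "operad_comp i = bilin_ext (word_comp i)"

text \<open>
  The full composition \<open>X \<circ> (E\<^sub>1, \<dots>, E\<^sub>n)\<close> is
  \<open>(\<dots>((X \<circ>\<^sub>n E\<^sub>n) \<circ>\<^sub>n\<^sub>-\<^sub>1 E\<^sub>n\<^sub>-\<^sub>1)\<dots>) \<circ>\<^sub>1 E\<^sub>1\<close>: composing from the right to the left leaves
  the positions still to be filled unchanged.
\<close>

definition operad_full_comp :: "'k::field wvec \<Rightarrow> 'k wvec list \<Rightarrow> 'k wvec" where
  "operad_full_comp X es =
     foldr (\<lambda>i Z. operad_comp i Z (es ! (i - 1))) [1..<Suc (length es)] X"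

text \<open>
  \<open>dias \<gamma> n X\<close> says that \<open>X\<close> belongs to the arity \<open>n\<close> component of the linear suboperad
  generated by the words \<open>0a\<close> and \<open>a0\<close> with \<open>a \<in> {1..\<gamma>}\<close>.
\<close>

inductive dias :: "nat \<Rightarrow> nat \<Rightarrow> 'k::field wvec \<Rightarrow> bool" for \<gamma> :: nat where
  zero: "n \<ge> 1 \<Longrightarrow> dias \<gamma> n 0"
| add: "dias \<gamma> n X \<Longrightarrow> dias \<gamma> n Y \<Longrightarrow> dias \<gamma> n (X + Y)"
| scale: "dias \<gamma> n X \<Longrightarrow> dias \<gamma> n (wscale c X)"
| unit: "dias \<gamma> 1 (word_vec [0])"
| gen_left: "a \<in> {1..\<gamma>} \<Longrightarrow> dias \<gamma> 2 (word_vec [0, a])"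
| gen_right: "a \<in> {1..\<gamma>} \<Longrightarrow> dias \<gamma> 2 (word_vec [a, 0])"
| comp: "dias \<gamma> n X \<Longrightarrow> dias \<gamma> m Y \<Longrightarrow> i \<in> {1..n} \<Longrightarrow>
    dias \<gamma> (n + m - 1) (operad_comp i X Y)"

text \<open>
  The free algebra over one generator on this operad. Its underlying space is the internal
  direct sum of the components: distinct components are supported on words of
  distinct lengths. The operations are the actions of the two families of generators.
\<close>

definition free_dias_space :: "nat \<Rightarrow> 'k::field wvec set" where
  "free_dias_space \<gamma> = wvec.span (\<Union>n\<in>{1..}. {X. dias \<gamma> n X})"

definition free_dias_left :: "nat \<Rightarrow> 'k::field wvec \<Rightarrow> 'k wvec \<Rightarrow> 'k wvec" where
  "free_dias_left a X Y = operad_full_comp (word_vec [0, a]) [X, Y]"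

definition free_dias_right :: "nat \<Rightarrow> 'k::field wvec \<Rightarrow> 'k wvec \<Rightarrow> 'k wvec" where
  "free_dias_right a X Y = operad_full_comp (word_vec [a, 0]) [X, Y]"

section \<open>The algebra of words with exactly one zero\<close>

definition one_zero_words :: "nat \<Rightarrow> nat list set" where
  "one_zero_words \<gamma> = {w. w \<noteq> [] \<and> set w \<subseteq> {0} \<union> {1..\<gamma>} \<and> count_list w 0 = 1}"

definition one_zero_space :: "nat \<Rightarrow> 'k::field wvec set" where
  "one_zero_space \<gamma> = {X. Poly_Mapping.keys X \<subseteq> one_zero_words \<gamma>}"

definition raise_letters :: "nat \<Rightarrow> nat list \<Rightarrow> nat list" where
  "raise_letters a w = map (\<lambda>x. if x < a then a else x) w"

definition word_left :: "nat \<Rightarrow> 'k::field wvec \<Rightarrow> 'k wvec \<Rightarrow> 'k wvec" where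
  "word_left a = bilin_ext (\<lambda>u v. u @ raise_letters a v)"

definition word_right :: "nat \<Rightarrow> 'k::field wvec \<Rightarrow> 'k wvec \<Rightarrow> 'k wvec" where
  "word_right a = bilin_ext (\<lambda>u v. raise_letters a u @ v)"

end

theory Submission
  imports Defs
begin

text \<open>
  A word with exactly one \<open>0\<close> is built from the word \<open>0\<close> by adding positive letters at either
  end, and \<open>a w = 0 \<turnstile>\<^sub>a w\<close>, \<open>w a = w \<stileturn>\<^sub>a 0\<close>. This determines a morphism by its value on \<open>0\<close>.
  Conversely, putting the letters left of \<open>0\<close> outermost defines a map on words;
  the relation \<open>(x \<turnstile> y) \<stileturn> z = x \<turnstile> (y \<stileturn> z)\<close> makes the order of the two ends irrelevant, and each of the
  other four relations is one step in the induction showing that the map is a morphism.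
\<close>

section \<open>Linear and bilinear extensions\<close>

lemma wscale_single [simp]: "wscale c (Poly_Mapping.single w d) = Poly_Mapping.single w (c * d)"
  by (rule poly_mapping_eqI) (simp add: lookup_single when_def)

lemma keys_wscale_subset: "Poly_Mapping.keys (wscale c X) \<subseteq> Poly_Mapping.keys X"
  by (auto simp: in_keys_iff)

text \<open>Reduces claims linear in a vector to words. The set \<open>A\<close> is kept in the
  induction because closure and evaluation behave well only on words with exactly one zero.\<close>

lemma keys_subset_induct [consumes 1, case_names zero add]:
  fixes X :: "'k::field wvec"
  assumes "Poly_Mapping.keys X \<subseteq> A"
    and zero: "P 0"
    and add: "\<And>w c X. w \<in> A \<Longrightarrow> Poly_Mapping.keys X \<subseteq> A \<Longrightarrow> P X \<Longrightarrow> P (wscale c (word_vec w) + X)"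
  shows "P X"
proof -
  let ?s = "\<lambda>w. Poly_Mapping.single w (Poly_Mapping.lookup X w)"
  \<comment> \<open>Bounds the support of each partial sum, as the hypothesis \<open>add\<close>
    demands for the vector built so far.\<close>
  have keys: "Poly_Mapping.keys (\<Sum>w\<in>B. ?s w) \<subseteq> B" for B
    using keys_sum[of ?s B] by (auto split: if_splits)
  have "P (\<Sum>w\<in>B. ?s w)" if "finite B" "B \<subseteq> A" for B
    using that
  proof (induction B rule: finite_induct)
    case (insert w B)
    then show ?case
      using add[of w "\<Sum>w\<in>B. ?s w" "Poly_Mapping.lookup X w"] keys[of B] by auto
  qed (simp add: zero)
  moreover have "(\<Sum>w\<in>Poly_Mapping.keys X. ?s w) = X"
    by (rule poly_mapping_eqI) (simp add: lookup_sum lookup_single when_def in_keys_iff)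
  ultimately show ?thesis
    using assms(1) by (metis finite_keys)
qed

text \<open>The target is any vector space over the same field: with \<open>wscale\<close> it is the
  space of word vectors, and later it is the space underlying an arbitrary algebra.\<close>

definition (in vector_space) lin_ext :: "(nat list \<Rightarrow> 'b) \<Rightarrow> 'a wvec \<Rightarrow> 'b" where
  "lin_ext \<phi> X = (\<Sum>w\<in>Poly_Mapping.keys X. scale (Poly_Mapping.lookup X w) (\<phi> w))"

text \<open>Cancellation can shrink the support of a sum, so vectors are compared over a common
  finite index set.\<close>

lemma (in vector_space) lin_ext_superset:
  fixes X :: "'a wvec"
  assumes "finite A" "Poly_Mapping.keys X \<subseteq> A"
  shows "lin_ext \<phi> X = (\<Sum>w\<in>A. scale (Poly_Mapping.lookup X w) (\<phi> w))"
  unfolding lin_ext_def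
  by (rule sum.mono_neutral_left) (use assms in \<open>auto simp: in_keys_iff\<close>)

lemma (in vector_space) lin_ext_zero [simp]: "lin_ext \<phi> 0 = 0"
  by (simp add: lin_ext_def)

lemma (in vector_space) lin_ext_add: "lin_ext \<phi> (X + Y) = lin_ext \<phi> X + lin_ext \<phi> Y"
proof -
  have "Poly_Mapping.keys (X + Y) \<subseteq> Poly_Mapping.keys X \<union> Poly_Mapping.keys Y" by (rule keys_add)
  then show ?thesis
    by (simp add: lin_ext_superset[of "Poly_Mapping.keys X \<union> Poly_Mapping.keys Y"] lookup_add scale_left_distrib
        sum.distrib)
qed

lemma (in vector_space) lin_ext_wscale: "lin_ext \<phi> (wscale c X) = scale c (lin_ext \<phi> X)"
  by (simp add: lin_ext_superset[of "Poly_Mapping.keys X"] keys_wscale_subset scale_sum_right)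

lemma (in vector_space) lin_ext_single [simp]: "lin_ext \<phi> (Poly_Mapping.single w c) = scale c (\<phi> w)"
  by (simp add: lin_ext_def)

lemma (in vector_space) lin_ext_mem:
  fixes X :: "'a wvec"
  assumes "subspace V" "\<And>w. w \<in> Poly_Mapping.keys X \<Longrightarrow> \<phi> w \<in> V"
  shows "lin_ext \<phi> X \<in> V"
  unfolding lin_ext_def using assms by (intro subspace_sum subspace_scale) auto

text \<open>Nesting two linear extensions lets the linearity of \<open>lin_ext\<close> give
  linearity in each argument: the outer one for \<open>X\<close>, the inner one for
  \<open>Y\<close>.\<close>

lemma bilin_ext_eq_lin_ext:
  "bilin_ext f X Y = wvec.lin_ext (\<lambda>u. wvec.lin_ext (\<lambda>v. word_vec (f u v)) Y) X"
  by (simp add: bilin_ext_def wvec.lin_ext_def wvec.scale_sum_right)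

lemma bilin_ext_zero [simp]: "bilin_ext f 0 Y = 0" "bilin_ext f X 0 = 0"
  by (simp_all add: bilin_ext_def)

lemma bilin_ext_add_left: "bilin_ext f (X + Y) Z = bilin_ext f X Z + bilin_ext f Y Z"
  by (simp add: bilin_ext_eq_lin_ext wvec.lin_ext_add)

lemma bilin_ext_scale_left: "bilin_ext f (wscale c X) Y = wscale c (bilin_ext f X Y)"
  by (simp add: bilin_ext_eq_lin_ext wvec.lin_ext_wscale)

lemma bilin_ext_add_right: "bilin_ext f X (Y + Z) = bilin_ext f X Y + bilin_ext f X Z"
  by (simp add: bilin_ext_def[of f X] bilin_ext_eq_lin_ext wvec.lin_ext_add,
      simp add: wvec.lin_ext_def wvec.scale_right_distrib sum.distrib)

lemma bilin_ext_scale_right: "bilin_ext f X (wscale c Y) = wscale c (bilin_ext f X Y)"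
  by (simp add: bilin_ext_eq_lin_ext wvec.lin_ext_wscale,
      simp add: wvec.lin_ext_def wvec.scale_sum_right wvec.scale_left_commute mult.left_commute)

lemma bilin_ext_single [simp]:
  "bilin_ext f (Poly_Mapping.single u c) (Poly_Mapping.single v d) =
    Poly_Mapping.single (f u v) (c * d)"
  by (simp add: bilin_ext_eq_lin_ext)

lemmas bilin_ext_linear =
  bilin_ext_add_left bilin_ext_add_right bilin_ext_scale_left bilin_ext_scale_right

lemma keys_bilin_ext: "Poly_Mapping.keys (bilin_ext f X Y) \<subseteq> {f u v |u v. u \<in> Poly_Mapping.keys X \<and> v \<in> Poly_Mapping.keys Y}"
proof
  fix w assume "w \<in> Poly_Mapping.keys (bilin_ext f X Y)"
  then have "Poly_Mapping.lookup (bilin_ext f X Y) w \<noteq> 0" by (simp add: in_keys_iff)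
  then obtain u v where "u \<in> Poly_Mapping.keys X" "v \<in> Poly_Mapping.keys Y"
    "Poly_Mapping.lookup (Poly_Mapping.single (f u v)
        (Poly_Mapping.lookup X u * Poly_Mapping.lookup Y v)) w \<noteq> 0"
    unfolding bilin_ext_def lookup_sum by (meson sum.neutral)
  then show "w \<in> {f u v |u v. u \<in> Poly_Mapping.keys X \<and> v \<in> Poly_Mapping.keys Y}"
    by (auto simp: lookup_single when_def split: if_splits)
qed

text \<open>Four separate word operations are allowed because every pluriassociative relation has
  this shape with different operations in the four places.\<close>

lemma bilin_ext_assoc:
  fixes X Y Z :: "'k::field wvec"
  assumes "\<And>u v w. f (g u v) w = h u (k v w)"
  shows "bilin_ext f (bilin_ext g X Y) Z = bilin_ext h X (bilin_ext k Y Z)"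
proof (induction X rule: keys_subset_induct[OF subset_UNIV])
  case X: (2 u c X)
  have "bilin_ext f (bilin_ext g (word_vec u) Y) Z = bilin_ext h (word_vec u) (bilin_ext k Y Z)"
  proof (induction Y rule: keys_subset_induct[OF subset_UNIV])
    case Y: (2 v d Y)
    \<comment> \<open>\<open>wscale_single\<close> is switched off below since it would absorb the
      scalar into the basis vector and hide the form that the linearity rules match.\<close>
    have "bilin_ext f (bilin_ext g (word_vec u) (word_vec v)) Z =
        bilin_ext h (word_vec u) (bilin_ext k (word_vec v) Z)"
      by (induction Z rule: keys_subset_induct[OF subset_UNIV])
        (simp_all add: bilin_ext_linear assms del: wscale_single)
    with Y show ?case by (simp add: bilin_ext_linear del: wscale_single)
  qed simp
  with X show ?case by (simp add: bilin_ext_linear del: wscale_single)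
qed simp

text \<open>Full composition of a generator \<open>p\<close> fills position 2 with \<open>Y\<close>
  before position 1 with \<open>X\<close>; this restores the usual order of the arguments.\<close>

lemma bilin_ext_word_vec_flip:
  fixes X Y :: "'k::field wvec"
  assumes "\<And>u v. f (g p v) u = h u v"
  shows "bilin_ext f (bilin_ext g (word_vec p) Y) X = bilin_ext h X Y"
proof (induction X rule: keys_subset_induct[OF subset_UNIV])
  case X: (2 u c X)
  have "bilin_ext f (bilin_ext g (word_vec p) Y) (word_vec u) = bilin_ext h (word_vec u) Y"
    by (induction Y rule: keys_subset_induct[OF subset_UNIV])
      (simp_all add: bilin_ext_linear assms del: wscale_single)
  with X show ?case by (simp add: bilin_ext_linear del: wscale_single)
qed simp

section \<open>Words with exactly one zero\<close>

lemma raise_letters_eq_map_max: "raise_letters a w = map (max a) w"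
  by (auto simp: raise_letters_def max_def)

lemma raise_letters_append [simp]:
  "raise_letters a (u @ v) = raise_letters a u @ raise_letters a v"
  by (simp add: raise_letters_def)

lemma raise_letters_raise_letters [simp]:
  "raise_letters a (raise_letters b w) = raise_letters (max a b) w"
  by (simp add: raise_letters_eq_map_max max.assoc)

lemma one_zero_words_iff:
  "w \<in> one_zero_words \<gamma> \<longleftrightarrow> set w \<subseteq> {..\<gamma>} \<and> count_list w 0 = 1"
proof -
  have "{0} \<union> {1..\<gamma>} = {..\<gamma>}" by auto
  then show ?thesis by (auto simp: one_zero_words_def)
qed

lemma zero_mem_one_zero_words: "[0] \<in> one_zero_words \<gamma>"
  by (simp add: one_zero_words_iff)

lemma Cons_mem_one_zero_words_iff:
  "x > 0 \<Longrightarrow> x # w \<in> one_zero_words \<gamma> \<longleftrightarrow> x \<le> \<gamma> \<and> w \<in> one_zero_words \<gamma>"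
  by (auto simp: one_zero_words_iff)

lemma snoc_mem_one_zero_words_iff:
  "x > 0 \<Longrightarrow> w @ [x] \<in> one_zero_words \<gamma> \<longleftrightarrow> x \<le> \<gamma> \<and> w \<in> one_zero_words \<gamma>"
  by (auto simp: one_zero_words_iff)

lemma map_max_zero: "map (max 0) w = (w :: nat list)"
  by (induction w) auto

lemma count_list_map_max: "a > 0 \<Longrightarrow> count_list (map (max a) w) (0::nat) = 0"
  by (induction w) auto

text \<open>As a >= 1, raising removes the zero of one factor, so only the zero of the other
  survives.\<close>

lemma append_raise_mem_one_zero_words:
  assumes "a \<in> {1..\<gamma>}" "u \<in> one_zero_words \<gamma>" "v \<in> one_zero_words \<gamma>"
  shows "u @ raise_letters a v \<in> one_zero_words \<gamma>" "raise_letters a u @ v \<in> one_zero_words \<gamma>"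
  using assms by (auto simp: one_zero_words_iff raise_letters_eq_map_max count_list_map_max)

lemma one_zero_words_induct [consumes 1, case_names zero Cons snoc]:
  assumes "w \<in> one_zero_words \<gamma>"
    and "P [0]"
    and Cons: "\<And>x w. x \<in> {1..\<gamma>} \<Longrightarrow> w \<in> one_zero_words \<gamma> \<Longrightarrow> P w \<Longrightarrow> P (x # w)"
    and snoc: "\<And>x w. x \<in> {1..\<gamma>} \<Longrightarrow> w \<in> one_zero_words \<gamma> \<Longrightarrow> P w \<Longrightarrow> P (w @ [x])"
  shows "P w"
  using assms(1)
proof (induction w rule: length_induct)
  case (1 w)
  from 1(2) obtain x w' where w: "w = x # w'"
    by (cases w) (auto simp: one_zero_words_iff)
  show ?case
  proof (cases "x = 0")
    case False
    then show ?thesis using 1 w Cons Cons_mem_one_zero_words_iff[of x w' \<gamma>] by auto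
  next
    case x: True
    show ?thesis
    proof (cases w' rule: rev_cases)
      case Nil
      then show ?thesis using w x assms(2) by simp
    next
      case (snoc v y)
      \<comment> \<open>The only zero is the first letter, so the last letter of a longer word is
        positive and can be split off.\<close>
      with 1(2) w x have "y > 0" by (auto simp: one_zero_words_iff intro: Nat.gr0I)
      then show ?thesis
        using 1 w snoc assms(4)[of y "x # v"] snoc_mem_one_zero_words_iff[of y "x # v" \<gamma>] by auto
    qed
  qed
qed

section \<open>Components of the suboperad and their words\<close>

lemma word_comp_mem_one_zero_words:
  assumes "u \<in> one_zero_words \<gamma>" "v \<in> one_zero_words \<gamma>" "i \<in> {1..length u}"
  shows "word_comp i u v \<in> one_zero_words \<gamma> \<and> length (word_comp i u v) = length u + length v - 1"
proof -
  \<comment> \<open>Positions count from 1: letter \<open>i\<close> is \<open>u ! (i - 1)\<close>,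
    and \<open>drop i u\<close> starts just after it.\<close>
  define p x q where "p = take (i - 1) u" and "x = u ! (i - 1)" and "q = drop i u"
  have u: "u = p @ x # q"
    unfolding p_def x_def q_def using assms(3) id_take_nth_drop[of "i - 1" u] by auto
  have "word_comp i u v = p @ map (max x) v @ q"
    by (simp add: word_comp_def p_def x_def q_def)
  \<comment> \<open>If \<open>x\<close> is 0, then \<open>v\<close> is inserted unchanged and its
    zero replaces the removed one. Otherwise the inserted block has no zero, and the zero of
    \<open>u\<close> survives in \<open>p\<close> or \<open>q\<close>.\<close>
  then show ?thesis
    using assms(1,2) unfolding u
    by (cases "x = 0") (auto simp: map_max_zero one_zero_words_iff count_list_map_max)
qed

text \<open>The length is carried along so that in the composition case \<open>i\<close> is a valid
  position of every word in the support.\<close>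

lemma dias_keys:
  assumes "dias \<gamma> n X"
  shows "Poly_Mapping.keys X \<subseteq> {w \<in> one_zero_words \<gamma>. length w = n}"
  using assms
proof (induction rule: dias.induct)
  case (add n X Y)
  then show ?case using keys_add[of X Y] by blast
next
  case (scale n X c)
  then show ?case using keys_wscale_subset[of c X] by blast
next
  case (comp n X m Y i)
  then have "word_comp i u v \<in> one_zero_words \<gamma> \<and> length (word_comp i u v) = n + m - 1"
    if "u \<in> Poly_Mapping.keys X" "v \<in> Poly_Mapping.keys Y" for u v
    using that word_comp_mem_one_zero_words[of u \<gamma> v i] by blast
  then show ?case
    unfolding operad_comp_def using keys_bilin_ext[of "word_comp i" X Y] by blast
qed (auto simp: one_zero_words_iff)

text \<open>Prepending \<open>x\<close> inserts the word at position 2 of \<open>[x, 0]\<close>, and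
  appending \<open>x\<close> inserts it at position 1 of \<open>[0, x]\<close>. In both cases the
  slot holds 0, so no letter is raised.\<close>

lemma dias_word_vec:
  assumes "w \<in> one_zero_words \<gamma>"
  shows "dias \<gamma> (length w) (word_vec w :: 'k::field wvec)"
  using assms
proof (induction w rule: one_zero_words_induct)
  case zero
  then show ?case using dias.unit by simp
next
  case (Cons x w)
  from dias.comp[OF dias.gen_right[OF Cons(1)] Cons(3), of 2] show ?case
    by (simp add: operad_comp_def word_comp_def map_max_zero)
next
  case (snoc x w)
  from dias.comp[OF dias.gen_left[OF snoc(1)] snoc(3), of 1] show ?case
    by (simp add: operad_comp_def word_comp_def map_max_zero)
qed

lemma subspace_one_zero_space: "wvec.subspace (one_zero_space \<gamma> :: 'k::field wvec set)"
  unfolding one_zero_space_def wvec.subspace_def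
  using keys_add keys_wscale_subset by fastforce

lemma one_zero_space_eq_free_dias_space:
  "(one_zero_space \<gamma> :: 'k::field wvec set) = free_dias_space \<gamma>"
proof
  show "one_zero_space \<gamma> \<subseteq> (free_dias_space \<gamma> :: 'k wvec set)"
  proof
    fix X :: "'k wvec" assume "X \<in> one_zero_space \<gamma>"
    then have "Poly_Mapping.keys X \<subseteq> one_zero_words \<gamma>" by (simp add: one_zero_space_def)
    then show "X \<in> free_dias_space \<gamma>"
    proof (induction X rule: keys_subset_induct)
      case zero
      show ?case by (simp add: free_dias_space_def wvec.span_zero)
    next
      case (add w c X)
      from add(1) have "length w \<ge> 1" by (cases w) (auto simp: one_zero_words_iff)
      with dias_word_vec[OF add(1), where 'k = 'k]
      have "word_vec w \<in> (free_dias_space \<gamma> :: 'k wvec set)"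
        unfolding free_dias_space_def by (intro wvec.span_base) auto
      with add(3) show ?case
        unfolding free_dias_space_def by (blast intro: wvec.span_add wvec.span_scale)
    qed
  qed
  show "free_dias_space \<gamma> \<subseteq> (one_zero_space \<gamma> :: 'k wvec set)"
    unfolding free_dias_space_def
    by (rule wvec.span_minimal[OF _ subspace_one_zero_space])
      (auto simp: one_zero_space_def dest: dias_keys)
qed

text \<open>In \<open>[0, a]\<close> the slot holding \<open>a\<close> raises the letters of the
  second argument, while the slot holding 0 leaves the first unchanged.\<close>

lemma word_left_eq_free_dias_left: "word_left a X Y = free_dias_left a X Y"
  by (simp add: word_left_def free_dias_left_def operad_full_comp_def operad_comp_def
      numeral_2_eq_2, intro bilin_ext_word_vec_flip[symmetric])
    (simp add: word_comp_def raise_letters_eq_map_max map_max_zero)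

lemma word_right_eq_free_dias_right: "word_right a X Y = free_dias_right a X Y"
  by (simp add: word_right_def free_dias_right_def operad_full_comp_def operad_comp_def
      numeral_2_eq_2, intro bilin_ext_word_vec_flip[symmetric])
    (simp add: word_comp_def raise_letters_eq_map_max map_max_zero)

lemma word_left_right_closed:
  assumes "a \<in> {1..\<gamma>}" "X \<in> one_zero_space \<gamma>" "Y \<in> one_zero_space \<gamma>"
  shows "word_left a X Y \<in> one_zero_space \<gamma>" "word_right a X Y \<in> one_zero_space \<gamma>"
  using assms append_raise_mem_one_zero_words[OF assms(1)]
    keys_bilin_ext[of "\<lambda>u v. u @ raise_letters a v" X Y]
    keys_bilin_ext[of "\<lambda>u v. raise_letters a u @ v" X Y]
  unfolding one_zero_space_def word_left_def word_right_def by blast+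

text \<open>On words, each relation follows from associativity of concatenation and from raising by
  \<open>b\<close> and then by \<open>a\<close> being raising by their maximum. The relations thus
  hold for all vectors; membership in the space matters for closure.\<close>

lemma pluriassociative_one_zero_space:
  "pluriassociative_algebra (wscale :: 'k::field \<Rightarrow> _) \<gamma> (one_zero_space \<gamma>) word_left word_right"
proof unfold_locales
  fix a a' and X Y Z :: "'k wvec"
  show "word_left a (word_right a' X Y) Z = word_right a' X (word_left a Y Z)"
    and "word_left a (word_left (max a a') X Y) Z = word_left a X (word_right a' Y Z)"
    and "word_right a (word_left a' X Y) Z = word_right a X (word_right (max a a') Y Z)"
    and "word_left (max a a') (word_left a X Y) Z = word_left a X (word_left a' Y Z)"
    and "word_right a (word_right a' X Y) Z = word_right (max a a') X (word_right a Y Z)"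
    unfolding word_left_def word_right_def by (rule bilin_ext_assoc; simp)+
qed (auto simp: subspace_one_zero_space word_left_right_closed,
    auto simp: word_left_def word_right_def bilin_ext_linear)

section \<open>The universal property\<close>

text \<open>Letters left of the zero become nested \<open>R\<close> operations, and letters right of
  it a left fold of \<open>L\<close> operations starting at \<open>g\<close>. The value on the empty
  word is a default, since a word with a zero is settled at that zero.\<close>

primrec word_eval ::
  "(nat \<Rightarrow> 'v \<Rightarrow> 'v \<Rightarrow> 'v) \<Rightarrow> (nat \<Rightarrow> 'v \<Rightarrow> 'v \<Rightarrow> 'v) \<Rightarrow> 'v \<Rightarrow> nat list \<Rightarrow> 'v"
where
  "word_eval L R g [] = g"
| "word_eval L R g (x # w) =
    (if x = 0 then foldl (\<lambda>y b. L b y g) g w else R x g (word_eval L R g w))"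

section \<open>Evaluation of words in an arbitrary pluriassociative algebra\<close>

context pluriassociative_algebra
begin

lemma foldl_L_mem:
  "\<lbrakk>g \<in> V; y \<in> V; set w \<subseteq> {1..\<gamma>}\<rbrakk> \<Longrightarrow> foldl (\<lambda>y b. L b y g) y w \<in> V"
  by (induction w arbitrary: y) (simp_all add: L_closed)

lemma word_eval_mem:
  assumes "g \<in> V" "set w \<subseteq> {..\<gamma>}" "count_list w 0 = 1"
  shows "word_eval L R g w \<in> V"
  using assms(2,3)
proof (induction w)
  case (Cons x w)
  show ?case
  proof (cases "x = 0")
    case True
    with Cons.prems have "0 \<notin> set w" by (simp add: count_list_0_iff)
    then have "\<forall>y\<in>set w. y \<noteq> 0" by metis
    with Cons.prems have "set w \<subseteq> {1..\<gamma>}" by (auto simp: Suc_le_eq)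
    with True assms(1) show ?thesis by (simp add: foldl_L_mem)
  next
    case False
    with Cons assms(1) show ?thesis by (auto intro!: R_closed simp: Suc_le_eq)
  qed
qed simp

lemma word_eval_one_zero_mem: "g \<in> V \<Longrightarrow> w \<in> one_zero_words \<gamma> \<Longrightarrow> word_eval L R g w \<in> V"
  by (simp add: one_zero_words_iff word_eval_mem)

text \<open>After a leading zero the new letter is the last step of the fold. After a leading
  positive letter \<open>y\<close>, \<open>rel_RL\<close> brings \<open>L x\<close> outside
  \<open>R y g\<close>.\<close>

lemma word_eval_snoc:
  assumes "g \<in> V" "w \<in> one_zero_words \<gamma>" "x \<in> {1..\<gamma>}"
  shows "word_eval L R g (w @ [x]) = L x (word_eval L R g w) g"
  using assms(2)
proof (induction w)
  case (Cons y w)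
  show ?case
  proof (cases "y = 0")
    case False
    then have "y \<in> {1..\<gamma>}" "w \<in> one_zero_words \<gamma>"
      using Cons.prems by (auto simp: Cons_mem_one_zero_words_iff)
    with Cons.IH False assms(1,3) show ?thesis by (simp add: rel_RL word_eval_one_zero_mem)
  qed simp
qed (simp add: one_zero_words_iff)

text \<open>The word \<open>u\<close> is generalized because a leading letter of \<open>v\<close>,
  raised to \<open>max a x\<close>, is handed over to the end of \<open>u\<close>;
  \<open>rel_L_right\<close> is this move on values. A trailing letter is peeled off by
  \<open>rel_LL\<close>.\<close>

lemma word_eval_append_raise:
  assumes g: "g \<in> V" and a: "a \<in> {1..\<gamma>}"
    and "u \<in> one_zero_words \<gamma>" "v \<in> one_zero_words \<gamma>"
  shows "word_eval L R g (u @ raise_letters a v) = L a (word_eval L R g u) (word_eval L R g v)"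
  using assms(4,3)
proof (induction v arbitrary: u rule: one_zero_words_induct)
  case zero
  \<comment> \<open>Since a >= 1, raising the word 0 gives the one-letter word
    \<open>[a]\<close>.\<close>
  then show ?case using g a by (simp add: word_eval_snoc raise_letters_def)
next
  case (Cons x v)
  have x: "max a x \<in> {1..\<gamma>}" using a Cons by auto
  have ux: "u @ [max a x] \<in> one_zero_words \<gamma>"
    using Cons(4) x by (subst snoc_mem_one_zero_words_iff) auto
  have "L a (word_eval L R g u) (R x g (word_eval L R g v)) =
      L a (L (max a x) (word_eval L R g u) g) (word_eval L R g v)"
    using Cons g a by (intro rel_L_right[symmetric]) (auto intro: word_eval_one_zero_mem)
  also have "\<dots> = word_eval L R g ((u @ [max a x]) @ raise_letters a v)"
    unfolding Cons.IH[OF ux] using Cons g x by (simp add: word_eval_snoc)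
  finally show ?case using Cons by (simp add: raise_letters_eq_map_max)
next
  case (snoc x v)
  have x: "max a x \<in> {1..\<gamma>}" using a snoc by auto
  have uv: "u @ raise_letters a v \<in> one_zero_words \<gamma>"
    using append_raise_mem_one_zero_words a snoc by blast
  have "L a (word_eval L R g u) (word_eval L R g (v @ [x])) =
      L a (word_eval L R g u) (L x (word_eval L R g v) g)"
    using snoc g by (simp add: word_eval_snoc)
  also have "\<dots> = L (max a x) (L a (word_eval L R g u) (word_eval L R g v)) g"
    using snoc g a by (intro rel_LL[symmetric]) (auto intro: word_eval_one_zero_mem)
  also have "\<dots> = word_eval L R g ((u @ raise_letters a v) @ [max a x])"
    unfolding word_eval_snoc[OF g uv x] using snoc by simp
  finally show ?case by (simp add: raise_letters_eq_map_max)
qed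

text \<open>The mirror induction runs on \<open>u\<close>: \<open>rel_RR\<close> peels off a leading
  letter, and \<open>rel_R_left\<close> hands a trailing letter, raised, to the front of
  \<open>v\<close>.\<close>

lemma word_eval_raise_append:
  assumes g: "g \<in> V" and a: "a \<in> {1..\<gamma>}"
    and "u \<in> one_zero_words \<gamma>" "v \<in> one_zero_words \<gamma>"
  shows "word_eval L R g (raise_letters a u @ v) = R a (word_eval L R g u) (word_eval L R g v)"
  using assms(3,4)
proof (induction u arbitrary: v rule: one_zero_words_induct)
  case zero
  then show ?case using a by (simp add: raise_letters_def)
next
  case (Cons x u)
  have "R a (R x g (word_eval L R g u)) (word_eval L R g v) =
      R (max a x) g (R a (word_eval L R g u) (word_eval L R g v))"
    using Cons g a by (intro rel_RR) (auto intro: word_eval_one_zero_mem)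
  then show ?case using Cons a by (simp add: raise_letters_eq_map_max)
next
  case (snoc x u)
  have x: "max a x \<in> {1..\<gamma>}" using a snoc by auto
  have xv: "max a x # v \<in> one_zero_words \<gamma>"
    using snoc(4) x by (subst Cons_mem_one_zero_words_iff) auto
  have "R a (word_eval L R g (u @ [x])) (word_eval L R g v) =
      R a (L x (word_eval L R g u) g) (word_eval L R g v)"
    using snoc g by (simp add: word_eval_snoc)
  also have "\<dots> = R a (word_eval L R g u) (R (max a x) g (word_eval L R g v))"
    using snoc g a by (intro rel_R_left) (auto intro: word_eval_one_zero_mem)
  also have "\<dots> = word_eval L R g (raise_letters a u @ (max a x # v))"
    unfolding snoc.IH[OF xv] using x by auto
  finally show ?case by (simp add: raise_letters_eq_map_max)
qed

section \<open>From words to vectors: existence and uniqueness of the morphism\<close>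

lemma L_R_zero [simp]:
  assumes "a \<in> {1..\<gamma>}" "x \<in> V"
  shows "L a 0 x = 0" "L a x 0 = 0" "R a 0 x = 0" "R a x 0 = 0"
  using assms L_scale_left[of a x x 0] L_scale_right[of a x x 0]
    R_scale_left[of a x x 0] R_scale_right[of a x x 0] by simp_all

text \<open>\<open>B\<close> stands for \<open>L a\<close> or \<open>R a\<close>, which are known to
  be bilinear on \<open>V\<close> only; hence the supports are confined to words whose values lie in
  \<open>V\<close>.\<close>

lemma lin_ext_bilin_ext:
  fixes X Y :: "'k wvec"
  assumes "Poly_Mapping.keys X \<subseteq> A" "Poly_Mapping.keys Y \<subseteq> A"
    and \<phi>: "\<And>w. w \<in> A \<Longrightarrow> \<phi> w \<in> V"
    and B: "\<And>u v. u \<in> A \<Longrightarrow> v \<in> A \<Longrightarrow> \<phi> (f u v) = B (\<phi> u) (\<phi> v)"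
    and zero: "\<And>x. x \<in> V \<Longrightarrow> B 0 x = 0" "\<And>x. x \<in> V \<Longrightarrow> B x 0 = 0"
    and add: "\<And>x y z. x \<in> V \<Longrightarrow> y \<in> V \<Longrightarrow> z \<in> V \<Longrightarrow> B (x + y) z = B x z + B y z"
      "\<And>x y z. x \<in> V \<Longrightarrow> y \<in> V \<Longrightarrow> z \<in> V \<Longrightarrow> B x (y + z) = B x y + B x z"
    and scale: "\<And>c x y. x \<in> V \<Longrightarrow> y \<in> V \<Longrightarrow> B (scale c x) y = scale c (B x y)"
      "\<And>c x y. x \<in> V \<Longrightarrow> y \<in> V \<Longrightarrow> B x (scale c y) = scale c (B x y)"
  shows "lin_ext \<phi> (bilin_ext f X Y) = B (lin_ext \<phi> X) (lin_ext \<phi> Y)"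
proof -
  have mem: "lin_ext \<phi> Z \<in> V" if "Poly_Mapping.keys Z \<subseteq> A" for Z
    using that \<phi> by (intro lin_ext_mem[OF V_subspace]) auto
  have sc: "scale c (\<phi> w) \<in> V" if "w \<in> A" for c w
    using that \<phi> subspace_scale[OF V_subspace] by blast
  note lin = bilin_ext_linear lin_ext_add lin_ext_wscale add scale
  show ?thesis using assms(1)
  proof (induction X rule: keys_subset_induct)
    case zero
    show ?case using mem[OF assms(2)] assms(5) by simp
  next
    case X: (add u c X)
    have "lin_ext \<phi> (bilin_ext f (word_vec u) Y) = B (\<phi> u) (lin_ext \<phi> Y)"
      using assms(2)
    proof (induction Y rule: keys_subset_induct)
      case zero
      show ?case using X \<phi> assms(6) by simp
    next
      case Y: (add v d Y)
      then show ?case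
        using X \<phi> sc mem B by (simp add: lin del: wscale_single)
    qed
    with X \<phi> sc mem assms(2) show ?case by (simp add: lin del: wscale_single)
  qed
qed

lemma pluriassociative_hom_word_eval:
  assumes "g \<in> V"
  shows "pluriassociative_hom \<gamma> wscale (one_zero_space \<gamma>) word_left word_right scale V L R
    (lin_ext (word_eval L R g))"
  unfolding pluriassociative_hom_def
proof (intro conjI ballI allI)
  show "lin_ext (word_eval L R g) \<in> one_zero_space \<gamma> \<rightarrow> V"
    using assms by (auto simp: one_zero_space_def intro!: lin_ext_mem V_subspace word_eval_one_zero_mem)
next
  fix a and X Y :: "'k wvec"
  assume a: "a \<in> {1..\<gamma>}" and XY: "X \<in> one_zero_space \<gamma>" "Y \<in> one_zero_space \<gamma>"
  from XY have keys: "Poly_Mapping.keys X \<subseteq> one_zero_words \<gamma>" "Poly_Mapping.keys Y \<subseteq> one_zero_words \<gamma>"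
    by (simp_all add: one_zero_space_def)
  show "lin_ext (word_eval L R g) (word_left a X Y) =
      L a (lin_ext (word_eval L R g) X) (lin_ext (word_eval L R g) Y)"
    unfolding word_left_def using a assms
    by (intro lin_ext_bilin_ext[OF keys])
      (simp_all add: word_eval_one_zero_mem word_eval_append_raise L_add_left L_add_right
        L_scale_left L_scale_right)
  show "lin_ext (word_eval L R g) (word_right a X Y) =
      R a (lin_ext (word_eval L R g) X) (lin_ext (word_eval L R g) Y)"
    unfolding word_right_def using a assms
    by (intro lin_ext_bilin_ext[OF keys])
      (simp_all add: word_eval_one_zero_mem word_eval_raise_append R_add_left R_add_right
        R_scale_left R_scale_right)
qed (simp_all add: lin_ext_add lin_ext_wscale)

lemma pluriassociative_hom_unique:
  assumes "g \<in> V"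
    and hom: "pluriassociative_hom \<gamma> wscale (one_zero_space \<gamma>) word_left word_right scale V L R f"
    and f0: "f (word_vec [0]) = g"
    and X: "X \<in> one_zero_space \<gamma>"
  shows "f X = lin_ext (word_eval L R g) X"
proof -
  have space: "word_vec w \<in> one_zero_space \<gamma>" if "w \<in> one_zero_words \<gamma>" for w
    using that by (simp add: one_zero_space_def)
  have f_add: "f (X + Y) = f X + f Y" if "X \<in> one_zero_space \<gamma>" "Y \<in> one_zero_space \<gamma>" for X Y
    using hom that by (simp add: pluriassociative_hom_def)
  have f_scale: "f (wscale c X) = scale c (f X)" if "X \<in> one_zero_space \<gamma>" for c X
    using hom that by (simp add: pluriassociative_hom_def)
  have f_ops: "f (word_left a X Y) = L a (f X) (f Y)" "f (word_right a X Y) = R a (f X) (f Y)"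
    if "a \<in> {1..\<gamma>}" "X \<in> one_zero_space \<gamma>" "Y \<in> one_zero_space \<gamma>" for a X Y
    using hom that by (simp_all add: pluriassociative_hom_def)
  have word: "f (word_vec w) = word_eval L R g w" if "w \<in> one_zero_words \<gamma>" for w
    using that
  proof (induction w rule: one_zero_words_induct)
    case zero
    show ?case using f0 by simp
  next
    case (Cons x w)
    have "word_vec (x # w) = word_right x (word_vec [0]) (word_vec w :: 'k wvec)"
      using Cons by (simp add: word_right_def raise_letters_def)
    then show ?case
      using Cons f0 by (simp add: f_ops space zero_mem_one_zero_words)
  next
    case (snoc x w)
    \<comment> \<open>\<open>word_eval\<close> recurses from the left, so matching this
      decomposition rests on \<open>word_eval_snoc\<close>.\<close>
    have "word_vec (w @ [x]) = word_left x (word_vec w) (word_vec [0] :: 'k wvec)"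
      using snoc by (simp add: word_left_def raise_letters_def)
    then show ?case
      using snoc f0 assms(1) by (simp add: f_ops space zero_mem_one_zero_words word_eval_snoc)
  qed
  from X have "Poly_Mapping.keys X \<subseteq> one_zero_words \<gamma>" by (simp add: one_zero_space_def)
  then show ?thesis
  proof (induction X rule: keys_subset_induct)
    case zero
    \<comment> \<open>That \<open>f\<close> vanishes at 0 comes from its compatibility with scaling
      by 0.\<close>
    have "0 \<in> one_zero_space \<gamma>" by (simp add: one_zero_space_def)
    from f_scale[OF this, of 0] show ?case by simp
  next
    case (add w c X)
    then have "wscale c (word_vec w) \<in> one_zero_space \<gamma>" "X \<in> one_zero_space \<gamma>"
      by (auto simp: one_zero_space_def)
    then show ?case
      using add f_scale[OF space[OF add(1)], of c] word[OF add(1)]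
      by (simp add: f_add lin_ext_add)
  qed
qed

lemma ex1_pluriassociative_hom:
  assumes "g \<in> V"
  shows "\<exists>!f. f \<in> extensional (one_zero_space \<gamma>) \<and>
    pluriassociative_hom \<gamma> wscale (one_zero_space \<gamma>) word_left word_right scale V L R f \<and>
    f (word_vec [0]) = g"
proof (rule ex1I)
  have mem: "word_vec [0] \<in> one_zero_space \<gamma>"
    by (simp add: one_zero_space_def zero_mem_one_zero_words)
  \<comment> \<open>A morphism is constrained only on the space. Restriction fixes its values
    elsewhere, and closure of the space under all operations keeps the restriction a
    morphism.\<close>
  let ?f = "restrict (lin_ext (word_eval L R g)) (one_zero_space \<gamma>)"
  show "?f \<in> extensional (one_zero_space \<gamma>) \<and>
    pluriassociative_hom \<gamma> wscale (one_zero_space \<gamma>) word_left word_right scale V L R ?f \<and>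
    ?f (word_vec [0]) = g"
    using pluriassociative_hom_word_eval[OF assms] mem
    by (auto simp: pluriassociative_hom_def word_left_right_closed
        wvec.subspace_add[OF subspace_one_zero_space]
        wvec.subspace_scale[OF subspace_one_zero_space])
  fix f
  assume "f \<in> extensional (one_zero_space \<gamma>) \<and>
    pluriassociative_hom \<gamma> wscale (one_zero_space \<gamma>) word_left word_right scale V L R f \<and>
    f (word_vec [0]) = g"
  then show "f = ?f"
    using pluriassociative_hom_unique[OF assms]
    by (intro extensionalityI[of _ "one_zero_space \<gamma>"]) auto
qed

end

theorem proposition3p1p1:
  fixes \<gamma> :: nat
  shows "pluriassociative_algebra (wscale :: 'k::field_char_0 \<Rightarrow> 'k wvec \<Rightarrow> 'k wvec) \<gamma>
           (one_zero_space \<gamma>) word_left word_right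
    \<and> (one_zero_space \<gamma> :: 'k wvec set) = free_dias_space \<gamma>
    \<and> (\<forall>a\<in>{1..\<gamma>}. \<forall>X\<in>one_zero_space \<gamma>. \<forall>Y\<in>one_zero_space \<gamma>.
           word_left a X Y = free_dias_left a X (Y :: 'k wvec) \<and>
           word_right a X Y = free_dias_right a X Y)
    \<and> (word_vec [0] :: 'k wvec) \<in> one_zero_space \<gamma>
    \<and> (\<forall>(scale :: 'k \<Rightarrow> 'v::ab_group_add \<Rightarrow> 'v) V L R g.
           pluriassociative_algebra scale \<gamma> V L R \<and> g \<in> V \<longrightarrow>
           (\<exists>!f. f \<in> extensional (one_zero_space \<gamma>) \<and>
             pluriassociative_hom \<gamma> wscale (one_zero_space \<gamma>) word_left word_right
               scale V L R f \<and>
             f (word_vec [0]) = g))"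
proof (intro conjI allI ballI impI)
  show "(word_vec [0] :: 'k wvec) \<in> one_zero_space \<gamma>"
    by (simp add: one_zero_space_def zero_mem_one_zero_words)
next
  fix scale :: "'k \<Rightarrow> 'v \<Rightarrow> 'v" and V L R g
  assume "pluriassociative_algebra scale \<gamma> V L R \<and> g \<in> V"
  then show "\<exists>!f. f \<in> extensional (one_zero_space \<gamma>) \<and>
      pluriassociative_hom \<gamma> wscale (one_zero_space \<gamma>) word_left word_right scale V L R f \<and>
      f (word_vec [0]) = g"
    by (intro pluriassociative_algebra.ex1_pluriassociative_hom) auto
qed (rule pluriassociative_one_zero_space one_zero_space_eq_free_dias_space
    word_left_eq_free_dias_left word_right_eq_free_dias_right)+

end
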